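(* Let $T:V\to\mathfrak g$ be a relative Rota-Baxter operator on a Lie-Yamaguti algebra $(\mathfrak g,[\cdot,\cdot],[\![\cdot,\cdot,\cdot]\!])$ (over a field $\mathbb K$ of characteristic $0$) with respect to a representation $(V;\rho,\mu)$. If two linear deformations $T_t^1=T+t\mathfrak T_1$ and $T_t^2=T+t\mathfrak T_2$ of $T$ are equivalent, then $\mathfrak T_1$ and $\mathfrak T_2$ are in the same class of the cohomology group $\mathcal H^1_T(V,\mathfrak g)$.
   Context: Lie-Yamaguti algebra: a vector space $\mathfrak g$ with a bilinear bracket $[\cdot,\cdot]:\wedge^2\mathfrak g\to\mathfrak g$ and a trilinear bracket $[\![\cdot,\cdot,\cdot]\!]:\wedge^2\mathfrak g\otimes\mathfrak g\to\mathfrak g$ such that for all $x,y,z,w,t\in\mathfrak g$: (1) $[[x,y],z]+[[y,z],x]+[[z,x],y]+[\![x,y,z]\!]+[\![y,z,x]\!]+[\![z,x,y]\!]=0$; (2) $[\![[x,y],z,w]\!]+[\![[y,z],x,w]\!]+[\![[z,x],y,w]\!]=0$; (3) $[\![x,y,[z,w]]\!]=[[\![x,y,z]\!],w]+[z,[\![x,y,w]\!]]$; (4) $[\![x,y,[\![z,w,t]\!]]\!]=[\![[\![x,y,z]\!],w,t]\!]+[\![z,[\![x,y,w]\!],t]\!]+[\![z,w,[\![x,y,t]\!]]\!]$. Representation $(V;\rho,\mu)$: a vector space $V$ with linear maps $\rho:\mathfrak g\to\mathfrak{gl}(V)$, $\mu:\otimes^2\mathfrak g\to\mathfrak{gl}(V)$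 such that, with $D(x,y)=D_{\rho,\mu}(x,y):=\mu(y,x)-\mu(x,y)+[\rho(x),\rho(y)]-\rho([x,y])$, for all $x,y,z,w\in\mathfrak g$: $\mu([x,y],z)-\mu(x,z)\rho(y)+\mu(y,z)\rho(x)=0$; $\mu(x,[y,z])-\rho(y)\mu(x,z)+\rho(z)\mu(x,y)=0$; $\rho([\![x,y,z]\!])=[D(x,y),\rho(z)]$; $\mu(z,w)\mu(x,y)-\mu(y,w)\mu(x,z)-\mu(x,[\![y,z,w]\!])+D(y,z)\mu(x,w)=0$; $\mu([\![x,y,z]\!],w)+\mu(z,[\![x,y,w]\!])=[D(x,y),\mu(z,w)]$. $D$ is skew-symmetric; for $\mathfrak X=\sum x_i\wedge y_i\in\wedge^2\mathfrak g$ write $D(\mathfrak X)=\sum D(x_i,y_i)$ and $\mathfrak L_{\mathfrak X}z=[\![\mathfrak X,z]\!]=\sum[\![x_i,y_i,z]\!]$. Relative Rota-Baxter operator on $\mathfrak g$ with respect to $(V;\rho,\mu)$: a linear map $T:V\to\mathfrak g$ with, for all $u,v,w\in V$, $[Tu,Tv]=T(\rho(Tu)v-\rho(Tv)u)$ and $[\![Tu,Tv,Tw]\!]=T(D(Tu,Tv)w+\mu(Tv,Tw)u-\mu(Tu,Tw)v)$. Homomorphism from a relative Rota-Baxter operator $T'$ to a relative Rota-Baxter operator $T$ (same $\mathfrak g$ and $(V;\rho,\mu)$): a pair $(\phi_{\mathfrak g},\phi_V)$ with $\phi_{\mathfrak g}:\mathfrak g\to\mathfrak g$ a Lie-Yamaguti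 algebra homomorphism (linear, preserving both brackets) and $\phi_V:V\to V$ linear such that $T\circ\phi_V=\phi_{\mathfrak g}\circ T'$, $\phi_V(\rho(x)v)=\rho(\phi_{\mathfrak g}(x))\phi_V(v)$, $\phi_V(\mu(x,y)v)=\mu(\phi_{\mathfrak g}(x),\phi_{\mathfrak g}(y))\phi_V(v)$ for all $x,y\in\mathfrak g$, $v\in V$. Linear deformation of $T$: $T_t=T+t\mathfrak T$ with $\mathfrak T:V\to\mathfrak g$ linear such that $T_t$ is a relative Rota-Baxter operator with respect to $(V;\rho,\mu)$ for all $t$. Two linear deformations $T^1_t=T+t\mathfrak T_1$, $T^2_t=T+t\mathfrak T_2$ are equivalent if there is $\mathfrak X\in\wedge^2\mathfrak g$ such that $(\mathrm{Id}_{\mathfrak g}+t\mathfrak L_{\mathfrak X},\mathrm{Id}_V+tD(\mathfrak X))$ is a homomorphism from $T^2_t$ to $T^1_t$ (for all $t$). Cohomology group $\mathcal H^1_T(V,\mathfrak g)=\mathcal Z^1_T/\mathcal B^1_T$: put $[u,v]_T=\rho(Tu)v-\rho(Tv)u$, $[\![u,v,w]\!]_T=D(Tu,Tv)w+\mu(Tv,Tw)u-\mu(Tu,Tw)v$, $\varrho(u)x=[Tu,x]+T(\rho(x)u)$, $\varpi(u,v)x=[\![x,Tu,Tv]\!]-T(D(x,Tu)v-\mu(x,Tv)u)$, $D_{\varrho,\varpi}(u,v)x=[\![Tu,Tv,x]\!]-T(\mu(Tv,x)u-\mu(Tu,x)v)$. $\mathcal Z^1_T$ is the space of linear $f:V\to\mathfrak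 g$ with $\varrho(u)f(v)-\varrho(v)f(u)-f([u,v]_T)=0$ and $D_{\varrho,\varpi}(u,v)f(w)+\varpi(v,w)f(u)-\varpi(u,w)f(v)-f([\![u,v,w]\!]_T)=0$ for all $u,v,w\in V$; $\mathcal B^1_T=\{\delta(\mathfrak X):\mathfrak X\in\wedge^2\mathfrak g\}$ where $\delta(\mathfrak X)v=T(D(\mathfrak X)v)-[\![\mathfrak X,Tv]\!]$. *)

theory Defs
  imports Complex_Main "HOL-Library.Poly_Mapping"
begin

section \<open>The exterior square of a vector space\<close>

text \<open>
  The exterior square of a vector space \<open>'g\<close> with scalar multiplication \<open>sg\<close> is the free vector
  space on \<open>'g \<times> 'g\<close> modulo the subspace spanned by the relations below; its elements are the
  cosets of that subspace.
\<close>

definition free_scale :: "'k::field \<Rightarrow> ('b \<Rightarrow>\<^sub>0 'k) \<Rightarrow> ('b \<Rightarrow>\<^sub>0 'k)" where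
  "free_scale c p = Poly_Mapping.map ((*) c) p"

definition pair_gen :: "'g \<Rightarrow> 'g \<Rightarrow> ('g \<times> 'g \<Rightarrow>\<^sub>0 'k::field)" where
  "pair_gen x y = Poly_Mapping.single (x, y) 1"

definition ext2_relations ::
  "('k::field \<Rightarrow> 'g::ab_group_add \<Rightarrow> 'g) \<Rightarrow> ('g \<times> 'g \<Rightarrow>\<^sub>0 'k) set" where
  "ext2_relations sg =
     {pair_gen (x + x') y - pair_gen x y - pair_gen x' y | x x' y. True} \<union>
     {pair_gen x (y + y') - pair_gen x y - pair_gen x y' | x y y'. True} \<union>
     {pair_gen (sg c x) y - free_scale c (pair_gen x y) | c x y. True} \<union>
     {pair_gen x (sg c y) - free_scale c (pair_gen x y) | c x y. True} \<union>
     {pair_gen x x | x. True}"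

definition ext2_class ::
  "('k::field \<Rightarrow> 'g::ab_group_add \<Rightarrow> 'g) \<Rightarrow> ('g \<times> 'g \<Rightarrow>\<^sub>0 'k) \<Rightarrow> ('g \<times> 'g \<Rightarrow>\<^sub>0 'k) set" where
  "ext2_class sg p = {q. q - p \<in> module.span free_scale (ext2_relations sg)}"

definition ext2 ::
  "('k::field \<Rightarrow> 'g::ab_group_add \<Rightarrow> 'g) \<Rightarrow> ('g \<times> 'g \<Rightarrow>\<^sub>0 'k) set set" where
  "ext2 sg = range (ext2_class sg)"

text \<open>
  The linear map induced on the exterior square by an alternating bilinear map \<open>f\<close>, namely
  \<open>\<Sum> x\<^sub>i \<and> y\<^sub>i \<mapsto> \<Sum> f x\<^sub>i y\<^sub>i\<close>.  It is evaluated on a chosen representative; the lemmas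
  \<open>ext2_lift_class\<close> and \<open>ext2_lift_wedges\<close> below show that the choice is irrelevant.
\<close>

definition free_lift ::
  "('k::field \<Rightarrow> 'w::ab_group_add \<Rightarrow> 'w) \<Rightarrow> ('g \<Rightarrow> 'g \<Rightarrow> 'w) \<Rightarrow> ('g \<times> 'g \<Rightarrow>\<^sub>0 'k) \<Rightarrow> 'w" where
  "free_lift sw f p =
     (\<Sum>(x, y)\<in>Poly_Mapping.keys p. sw (Poly_Mapping.lookup p (x, y)) (f x y))"

definition ext2_lift ::
  "('k::field \<Rightarrow> 'w::ab_group_add \<Rightarrow> 'w) \<Rightarrow> ('g \<Rightarrow> 'g \<Rightarrow> 'w) \<Rightarrow> ('g \<times> 'g \<Rightarrow>\<^sub>0 'k) set \<Rightarrow> 'w" where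
  "ext2_lift sw f X = free_lift sw f (SOME p. p \<in> X)"

definition alternating_bilinear ::
  "('k::field \<Rightarrow> 'g::ab_group_add \<Rightarrow> 'g) \<Rightarrow> ('k \<Rightarrow> 'w::ab_group_add \<Rightarrow> 'w) \<Rightarrow>
   ('g \<Rightarrow> 'g \<Rightarrow> 'w) \<Rightarrow> bool" where
  "alternating_bilinear sg sw f \<longleftrightarrow>
     (\<forall>y. Vector_Spaces.linear sg sw (\<lambda>x. f x y)) \<and>
     (\<forall>x. Vector_Spaces.linear sg sw (f x)) \<and>
     (\<forall>x. f x x = 0)"

lemma lookup_free_scale: "Poly_Mapping.lookup (free_scale c p) k = c * Poly_Mapping.lookup p k"
  by (simp add: free_scale_def Poly_Mapping.map.rep_eq when_def)

lemma vector_space_free_scale: "vector_space free_scale"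
  by unfold_locales (rule poly_mapping_eqI, simp add: lookup_free_scale lookup_add algebra_simps)+

lemma free_lift_superset:
  assumes "vector_space sw" "finite A" "Poly_Mapping.keys p \<subseteq> A"
  shows "free_lift sw f p = (\<Sum>(x, y)\<in>A. sw (Poly_Mapping.lookup p (x, y)) (f x y))"
proof -
  interpret vector_space sw by fact
  show ?thesis unfolding free_lift_def
    by (rule sum.mono_neutral_left)
       (use assms in \<open>auto simp: in_keys_iff\<close>)
qed

lemma free_lift_add:
  assumes "vector_space sw"
  shows "free_lift sw f (p + q) = free_lift sw f p + free_lift sw f q"
proof -
  interpret vector_space sw by fact
  let ?A = "Poly_Mapping.keys p \<union> Poly_Mapping.keys q"
  have sub: "Poly_Mapping.keys (p + q) \<subseteq> ?A" by (rule Poly_Mapping.keys_add)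
  show ?thesis
    unfolding free_lift_superset[OF assms _ sub, simplified]
      free_lift_superset[OF assms, of ?A p, simplified]
      free_lift_superset[OF assms, of ?A q, simplified]
    by (simp add: lookup_add scale_left_distrib sum.distrib case_prod_unfold)
qed

lemma free_lift_scale:
  assumes "vector_space sw"
  shows "free_lift sw f (free_scale c p) = sw c (free_lift sw f p)"
proof -
  interpret vector_space sw by fact
  have sub: "Poly_Mapping.keys (free_scale c p) \<subseteq> Poly_Mapping.keys p"
    by (auto simp: in_keys_iff lookup_free_scale)
  show ?thesis
    unfolding free_lift_superset[OF assms _ sub, simplified]
    by (simp add: free_lift_def lookup_free_scale scale_sum_right case_prod_unfold)
qed

lemma free_lift_0 [simp]: "free_lift sw f 0 = 0"
  by (simp add: free_lift_def)

lemma free_lift_diff: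
  assumes "vector_space sw"
  shows "free_lift sw f (p - q) = free_lift sw f p - free_lift sw f q"
  using free_lift_add[OF assms, of f "p - q" q] by simp

lemma free_lift_pair_gen:
  assumes "vector_space sw"
  shows "free_lift sw f (pair_gen x y) = f x y"
proof -
  interpret vector_space sw by fact
  show ?thesis by (simp add: free_lift_def pair_gen_def)
qed

lemma free_lift_span:
  assumes f: "alternating_bilinear sg sw f"
    and p: "p \<in> module.span free_scale (ext2_relations sg)"
  shows "free_lift sw f p = 0"
proof -
  interpret F: vector_space "free_scale :: 'a \<Rightarrow> ('b \<times> 'b \<Rightarrow>\<^sub>0 'a) \<Rightarrow> _"
    by (rule vector_space_free_scale)
  from f have l1: "\<And>y. Vector_Spaces.linear sg sw (\<lambda>x. f x y)"
    and l2: "\<And>x. Vector_Spaces.linear sg sw (f x)" and z: "\<And>x. f x x = 0"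
    by (auto simp: alternating_bilinear_def)
  have W: "vector_space sw"
    using l2 by (simp add: Vector_Spaces.linear_iff)
  interpret W: vector_space sw by (rule W)
  show ?thesis
    using p
  proof (induction rule: F.span_induct)
    case base
    show ?case
      by (rule F.subspaceI) (simp_all add: free_lift_add[OF W] free_lift_scale[OF W])
  next
    case (step r)
    then show ?case
      using l1 l2 z
      by (auto simp: ext2_relations_def free_lift_diff[OF W] free_lift_scale[OF W]
          free_lift_pair_gen[OF W] Vector_Spaces.linear_iff)
  qed
qed

lemma ext2_lift_class:
  assumes f: "alternating_bilinear sg sw f"
  shows "ext2_lift sw f (ext2_class sg p) = free_lift sw f p"
proof -
  interpret F: vector_space "free_scale :: 'a \<Rightarrow> ('b \<times> 'b \<Rightarrow>\<^sub>0 'a) \<Rightarrow> _"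
    by (rule vector_space_free_scale)
  have W: "vector_space sw"
    using f by (simp add: alternating_bilinear_def Vector_Spaces.linear_iff)
  have "p \<in> ext2_class sg p"
    by (simp add: ext2_class_def F.span_zero)
  then have "(SOME q. q \<in> ext2_class sg p) \<in> ext2_class sg p"
    by (rule someI)
  then have "free_lift sw f ((SOME q. q \<in> ext2_class sg p) - p) = 0"
    unfolding ext2_class_def by (intro free_lift_span[OF f]) simp
  then show ?thesis
    by (simp add: ext2_lift_def free_lift_diff[OF W])
qed

lemma ext2_lift_wedges:
  assumes f: "alternating_bilinear sg sw f" and "finite I"
  shows "ext2_lift sw f (ext2_class sg (\<Sum>i\<in>I. pair_gen (x i) (y i))) = (\<Sum>i\<in>I. f (x i) (y i))"
proof -
  have W: "vector_space sw"
    using f by (simp add: alternating_bilinear_def Vector_Spaces.linear_iff)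
  from \<open>finite I\<close> show ?thesis
    unfolding ext2_lift_class[OF f]
    by (induction I) (simp_all add: free_lift_add[OF W] free_lift_pair_gen[OF W])
qed


section \<open>Lie-Yamaguti algebras and representations\<close>

locale lie_yamaguti_algebra = vector_space sg
  for sg :: "'k::field_char_0 \<Rightarrow> 'g::ab_group_add \<Rightarrow> 'g" +
  fixes br :: "'g \<Rightarrow> 'g \<Rightarrow> 'g"
    and tbr :: "'g \<Rightarrow> 'g \<Rightarrow> 'g \<Rightarrow> 'g"
  assumes br_alternating: "alternating_bilinear sg sg br"
    and tbr_alternating: "\<And>z. alternating_bilinear sg sg (\<lambda>x y. tbr x y z)"
    and tbr_linear: "\<And>x y. Vector_Spaces.linear sg sg (tbr x y)"
    and LY1: "\<And>x y z. br (br x y) z + br (br y z) x + br (br z x) y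
                + tbr x y z + tbr y z x + tbr z x y = 0"
    and LY2: "\<And>x y z w. tbr (br x y) z w + tbr (br y z) x w + tbr (br z x) y w = 0"
    and LY3: "\<And>x y z w. tbr x y (br z w) = br (tbr x y z) w + br z (tbr x y w)"
    and LY4: "\<And>x y z w t. tbr x y (tbr z w t)
                = tbr (tbr x y z) w t + tbr z (tbr x y w) t + tbr z w (tbr x y t)"

definition rep_D ::
  "('g \<Rightarrow> 'g \<Rightarrow> 'g) \<Rightarrow> ('g \<Rightarrow> 'v::ab_group_add \<Rightarrow> 'v) \<Rightarrow> ('g \<Rightarrow> 'g \<Rightarrow> 'v \<Rightarrow> 'v) \<Rightarrow>
   'g \<Rightarrow> 'g \<Rightarrow> 'v \<Rightarrow> 'v" where
  "rep_D br \<rho> \<mu> x y v =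
     \<mu> y x v - \<mu> x y v + (\<rho> x (\<rho> y v) - \<rho> y (\<rho> x v)) - \<rho> (br x y) v"

locale lie_yamaguti_representation =
  lie_yamaguti_algebra sg br tbr + V: vector_space sv
  for sg :: "'k::field_char_0 \<Rightarrow> 'g::ab_group_add \<Rightarrow> 'g" and br tbr
    and sv :: "'k \<Rightarrow> 'v::ab_group_add \<Rightarrow> 'v" +
  fixes \<rho> :: "'g \<Rightarrow> 'v \<Rightarrow> 'v"
    and \<mu> :: "'g \<Rightarrow> 'g \<Rightarrow> 'v \<Rightarrow> 'v"
  assumes rho_endo: "\<And>x. Vector_Spaces.linear sv sv (\<rho> x)"
    and rho_linear: "\<And>v. Vector_Spaces.linear sg sv (\<lambda>x. \<rho> x v)"
    and mu_endo: "\<And>x y. Vector_Spaces.linear sv sv (\<mu> x y)"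
    and mu_linear_left: "\<And>y v. Vector_Spaces.linear sg sv (\<lambda>x. \<mu> x y v)"
    and mu_linear_right: "\<And>x v. Vector_Spaces.linear sg sv (\<lambda>y. \<mu> x y v)"
    and R1: "\<And>x y z v. \<mu> (br x y) z v - \<mu> x z (\<rho> y v) + \<mu> y z (\<rho> x v) = 0"
    and R2: "\<And>x y z v. \<mu> x (br y z) v - \<rho> y (\<mu> x z v) + \<rho> z (\<mu> x y v) = 0"
    and R3: "\<And>x y z v. \<rho> (tbr x y z) v
               = rep_D br \<rho> \<mu> x y (\<rho> z v) - \<rho> z (rep_D br \<rho> \<mu> x y v)"
    and R4: "\<And>x y z w v. \<mu> z w (\<mu> x y v) - \<mu> y w (\<mu> x z v) - \<mu> x (tbr y z w) v
               + rep_D br \<rho> \<mu> y z (\<mu> x w v) = 0"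
    and R5: "\<And>x y z w v. \<mu> (tbr x y z) w v + \<mu> z (tbr x y w) v
               = rep_D br \<rho> \<mu> x y (\<mu> z w v) - \<mu> z w (rep_D br \<rho> \<mu> x y v)"

text \<open>The maps \<open>D(X)\<close> and \<open>L\<^sub>X\<close> for \<open>X\<close> in the exterior square.\<close>

definition ext2_D ::
  "('g \<Rightarrow> 'g \<Rightarrow> 'g) \<Rightarrow> ('k::field \<Rightarrow> 'v::ab_group_add \<Rightarrow> 'v) \<Rightarrow> ('g \<Rightarrow> 'v \<Rightarrow> 'v) \<Rightarrow>
   ('g \<Rightarrow> 'g \<Rightarrow> 'v \<Rightarrow> 'v) \<Rightarrow> ('g \<times> 'g \<Rightarrow>\<^sub>0 'k) set \<Rightarrow> 'v \<Rightarrow> 'v" where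
  "ext2_D br sv \<rho> \<mu> X v = ext2_lift sv (\<lambda>x y. rep_D br \<rho> \<mu> x y v) X"

definition ext2_L ::
  "('k::field \<Rightarrow> 'g::ab_group_add \<Rightarrow> 'g) \<Rightarrow> ('g \<Rightarrow> 'g \<Rightarrow> 'g \<Rightarrow> 'g) \<Rightarrow>
   ('g \<times> 'g \<Rightarrow>\<^sub>0 'k) set \<Rightarrow> 'g \<Rightarrow> 'g" where
  "ext2_L sg tbr X z = ext2_lift sg (\<lambda>x y. tbr x y z) X"

lemma (in lie_yamaguti_representation) rep_D_alternating:
  "alternating_bilinear sg sv (\<lambda>x y. rep_D br \<rho> \<mu> x y v)"
proof -
  have "\<rho> (0 + 0) v = \<rho> 0 v + \<rho> 0 v"
    using rho_linear[of v] unfolding Vector_Spaces.linear_iff by blast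
  then have "\<rho> 0 v = 0" by simp
  then show ?thesis
    using br_alternating rho_endo rho_linear mu_linear_left mu_linear_right
    by (auto simp: alternating_bilinear_def rep_D_def Vector_Spaces.linear_iff
        V.scale_right_diff_distrib V.scale_right_distrib algebra_simps)
qed


section \<open>Relative Rota-Baxter operators and their linear deformations\<close>

definition relative_rota_baxter ::
  "('k::field \<Rightarrow> 'g::ab_group_add \<Rightarrow> 'g) \<Rightarrow> ('g \<Rightarrow> 'g \<Rightarrow> 'g) \<Rightarrow> ('g \<Rightarrow> 'g \<Rightarrow> 'g \<Rightarrow> 'g) \<Rightarrow>
   ('k \<Rightarrow> 'v::ab_group_add \<Rightarrow> 'v) \<Rightarrow> ('g \<Rightarrow> 'v \<Rightarrow> 'v) \<Rightarrow> ('g \<Rightarrow> 'g \<Rightarrow> 'v \<Rightarrow> 'v) \<Rightarrow>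
   ('v \<Rightarrow> 'g) \<Rightarrow> bool" where
  "relative_rota_baxter sg br tbr sv \<rho> \<mu> T \<longleftrightarrow>
     Vector_Spaces.linear sv sg T \<and>
     (\<forall>u v. br (T u) (T v) = T (\<rho> (T u) v - \<rho> (T v) u)) \<and>
     (\<forall>u v w. tbr (T u) (T v) (T w)
        = T (rep_D br \<rho> \<mu> (T u) (T v) w + \<mu> (T v) (T w) u - \<mu> (T u) (T w) v))"

definition lie_yamaguti_hom ::
  "('k::field \<Rightarrow> 'g::ab_group_add \<Rightarrow> 'g) \<Rightarrow> ('g \<Rightarrow> 'g \<Rightarrow> 'g) \<Rightarrow> ('g \<Rightarrow> 'g \<Rightarrow> 'g \<Rightarrow> 'g) \<Rightarrow>
   ('g \<Rightarrow> 'g) \<Rightarrow> bool" where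
  "lie_yamaguti_hom sg br tbr \<phi> \<longleftrightarrow>
     Vector_Spaces.linear sg sg \<phi> \<and>
     (\<forall>x y. \<phi> (br x y) = br (\<phi> x) (\<phi> y)) \<and>
     (\<forall>x y z. \<phi> (tbr x y z) = tbr (\<phi> x) (\<phi> y) (\<phi> z))"

text \<open>Homomorphisms from \<open>T'\<close> to \<open>T\<close>.\<close>

definition rota_baxter_hom ::
  "('k::field \<Rightarrow> 'g::ab_group_add \<Rightarrow> 'g) \<Rightarrow> ('g \<Rightarrow> 'g \<Rightarrow> 'g) \<Rightarrow> ('g \<Rightarrow> 'g \<Rightarrow> 'g \<Rightarrow> 'g) \<Rightarrow>
   ('k \<Rightarrow> 'v::ab_group_add \<Rightarrow> 'v) \<Rightarrow> ('g \<Rightarrow> 'v \<Rightarrow> 'v) \<Rightarrow> ('g \<Rightarrow> 'g \<Rightarrow> 'v \<Rightarrow> 'v) \<Rightarrow>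
   ('v \<Rightarrow> 'g) \<Rightarrow> ('v \<Rightarrow> 'g) \<Rightarrow> ('g \<Rightarrow> 'g) \<Rightarrow> ('v \<Rightarrow> 'v) \<Rightarrow> bool" where
  "rota_baxter_hom sg br tbr sv \<rho> \<mu> T' T \<phi>g \<phi>V \<longleftrightarrow>
     lie_yamaguti_hom sg br tbr \<phi>g \<and>
     Vector_Spaces.linear sv sv \<phi>V \<and>
     T \<circ> \<phi>V = \<phi>g \<circ> T' \<and>
     (\<forall>x v. \<phi>V (\<rho> x v) = \<rho> (\<phi>g x) (\<phi>V v)) \<and>
     (\<forall>x y v. \<phi>V (\<mu> x y v) = \<mu> (\<phi>g x) (\<phi>g y) (\<phi>V v))"

definition deform ::
  "('k \<Rightarrow> 'g::ab_group_add \<Rightarrow> 'g) \<Rightarrow> ('v \<Rightarrow> 'g) \<Rightarrow> ('v \<Rightarrow> 'g) \<Rightarrow> 'k \<Rightarrow> 'v \<Rightarrow> 'g" where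
  "deform sg T S t v = T v + sg t (S v)"

definition linear_deformation ::
  "('k::field \<Rightarrow> 'g::ab_group_add \<Rightarrow> 'g) \<Rightarrow> ('g \<Rightarrow> 'g \<Rightarrow> 'g) \<Rightarrow> ('g \<Rightarrow> 'g \<Rightarrow> 'g \<Rightarrow> 'g) \<Rightarrow>
   ('k \<Rightarrow> 'v::ab_group_add \<Rightarrow> 'v) \<Rightarrow> ('g \<Rightarrow> 'v \<Rightarrow> 'v) \<Rightarrow> ('g \<Rightarrow> 'g \<Rightarrow> 'v \<Rightarrow> 'v) \<Rightarrow>
   ('v \<Rightarrow> 'g) \<Rightarrow> ('v \<Rightarrow> 'g) \<Rightarrow> bool" where
  "linear_deformation sg br tbr sv \<rho> \<mu> T S \<longleftrightarrow>
     Vector_Spaces.linear sv sg S \<and>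
     (\<forall>t. relative_rota_baxter sg br tbr sv \<rho> \<mu> (deform sg T S t))"

definition equivalent_deformations ::
  "('k::field \<Rightarrow> 'g::ab_group_add \<Rightarrow> 'g) \<Rightarrow> ('g \<Rightarrow> 'g \<Rightarrow> 'g) \<Rightarrow> ('g \<Rightarrow> 'g \<Rightarrow> 'g \<Rightarrow> 'g) \<Rightarrow>
   ('k \<Rightarrow> 'v::ab_group_add \<Rightarrow> 'v) \<Rightarrow> ('g \<Rightarrow> 'v \<Rightarrow> 'v) \<Rightarrow> ('g \<Rightarrow> 'g \<Rightarrow> 'v \<Rightarrow> 'v) \<Rightarrow>
   ('v \<Rightarrow> 'g) \<Rightarrow> ('v \<Rightarrow> 'g) \<Rightarrow> ('v \<Rightarrow> 'g) \<Rightarrow> bool" where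
  "equivalent_deformations sg br tbr sv \<rho> \<mu> T S1 S2 \<longleftrightarrow>
     (\<exists>X\<in>ext2 sg. \<forall>t. rota_baxter_hom sg br tbr sv \<rho> \<mu> (deform sg T S2 t) (deform sg T S1 t)
        (\<lambda>x. x + sg t (ext2_L sg tbr X x))
        (\<lambda>v. v + sv t (ext2_D br sv \<rho> \<mu> X v)))"


section \<open>The first cohomology group of a relative Rota-Baxter operator\<close>

definition RB_br :: "('g \<Rightarrow> 'v::ab_group_add \<Rightarrow> 'v) \<Rightarrow> ('v \<Rightarrow> 'g) \<Rightarrow> 'v \<Rightarrow> 'v \<Rightarrow> 'v" where
  "RB_br \<rho> T u v = \<rho> (T u) v - \<rho> (T v) u"

definition RB_tbr ::
  "('g \<Rightarrow> 'g \<Rightarrow> 'g) \<Rightarrow> ('g \<Rightarrow> 'v::ab_group_add \<Rightarrow> 'v) \<Rightarrow> ('g \<Rightarrow> 'g \<Rightarrow> 'v \<Rightarrow> 'v) \<Rightarrow> ('v \<Rightarrow> 'g) \<Rightarrow>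
   'v \<Rightarrow> 'v \<Rightarrow> 'v \<Rightarrow> 'v" where
  "RB_tbr br \<rho> \<mu> T u v w =
     rep_D br \<rho> \<mu> (T u) (T v) w + \<mu> (T v) (T w) u - \<mu> (T u) (T w) v"

definition RB_rho ::
  "('g::ab_group_add \<Rightarrow> 'g \<Rightarrow> 'g) \<Rightarrow> ('g \<Rightarrow> 'v::ab_group_add \<Rightarrow> 'v) \<Rightarrow> ('v \<Rightarrow> 'g) \<Rightarrow>
   'v \<Rightarrow> 'g \<Rightarrow> 'g" where
  "RB_rho br \<rho> T u x = br (T u) x + T (\<rho> x u)"

definition RB_mu ::
  "('g::ab_group_add \<Rightarrow> 'g \<Rightarrow> 'g) \<Rightarrow> ('g \<Rightarrow> 'g \<Rightarrow> 'g \<Rightarrow> 'g) \<Rightarrow> ('g \<Rightarrow> 'v::ab_group_add \<Rightarrow> 'v) \<Rightarrow>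
   ('g \<Rightarrow> 'g \<Rightarrow> 'v \<Rightarrow> 'v) \<Rightarrow> ('v \<Rightarrow> 'g) \<Rightarrow> 'v \<Rightarrow> 'v \<Rightarrow> 'g \<Rightarrow> 'g" where
  "RB_mu br tbr \<rho> \<mu> T u v x =
     tbr x (T u) (T v) - T (rep_D br \<rho> \<mu> x (T u) v - \<mu> x (T v) u)"

definition RB_D ::
  "('g::ab_group_add \<Rightarrow> 'g \<Rightarrow> 'g \<Rightarrow> 'g) \<Rightarrow> ('g \<Rightarrow> 'g \<Rightarrow> 'v::ab_group_add \<Rightarrow> 'v) \<Rightarrow>
   ('v \<Rightarrow> 'g) \<Rightarrow> 'v \<Rightarrow> 'v \<Rightarrow> 'g \<Rightarrow> 'g" where
  "RB_D tbr \<mu> T u v x = tbr (T u) (T v) x - T (\<mu> (T v) x u - \<mu> (T u) x v)"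

definition RB_cocycles ::
  "('k::field \<Rightarrow> 'g::ab_group_add \<Rightarrow> 'g) \<Rightarrow> ('g \<Rightarrow> 'g \<Rightarrow> 'g) \<Rightarrow> ('g \<Rightarrow> 'g \<Rightarrow> 'g \<Rightarrow> 'g) \<Rightarrow>
   ('k \<Rightarrow> 'v::ab_group_add \<Rightarrow> 'v) \<Rightarrow> ('g \<Rightarrow> 'v \<Rightarrow> 'v) \<Rightarrow> ('g \<Rightarrow> 'g \<Rightarrow> 'v \<Rightarrow> 'v) \<Rightarrow>
   ('v \<Rightarrow> 'g) \<Rightarrow> ('v \<Rightarrow> 'g) set" where
  "RB_cocycles sg br tbr sv \<rho> \<mu> T = {f. Vector_Spaces.linear sv sg f \<and>
     (\<forall>u v. RB_rho br \<rho> T u (f v) - RB_rho br \<rho> T v (f u) - f (RB_br \<rho> T u v) = 0) \<and>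
     (\<forall>u v w. RB_D tbr \<mu> T u v (f w) + RB_mu br tbr \<rho> \<mu> T v w (f u)
        - RB_mu br tbr \<rho> \<mu> T u w (f v) - f (RB_tbr br \<rho> \<mu> T u v w) = 0)}"

definition RB_delta ::
  "('k::field \<Rightarrow> 'g::ab_group_add \<Rightarrow> 'g) \<Rightarrow> ('g \<Rightarrow> 'g \<Rightarrow> 'g) \<Rightarrow> ('g \<Rightarrow> 'g \<Rightarrow> 'g \<Rightarrow> 'g) \<Rightarrow>
   ('k \<Rightarrow> 'v::ab_group_add \<Rightarrow> 'v) \<Rightarrow> ('g \<Rightarrow> 'v \<Rightarrow> 'v) \<Rightarrow> ('g \<Rightarrow> 'g \<Rightarrow> 'v \<Rightarrow> 'v) \<Rightarrow>
   ('v \<Rightarrow> 'g) \<Rightarrow> ('g \<times> 'g \<Rightarrow>\<^sub>0 'k) set \<Rightarrow> 'v \<Rightarrow> 'g" where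
  "RB_delta sg br tbr sv \<rho> \<mu> T X v = T (ext2_D br sv \<rho> \<mu> X v) - ext2_L sg tbr X (T v)"

definition RB_coboundaries ::
  "('k::field \<Rightarrow> 'g::ab_group_add \<Rightarrow> 'g) \<Rightarrow> ('g \<Rightarrow> 'g \<Rightarrow> 'g) \<Rightarrow> ('g \<Rightarrow> 'g \<Rightarrow> 'g \<Rightarrow> 'g) \<Rightarrow>
   ('k \<Rightarrow> 'v::ab_group_add \<Rightarrow> 'v) \<Rightarrow> ('g \<Rightarrow> 'v \<Rightarrow> 'v) \<Rightarrow> ('g \<Rightarrow> 'g \<Rightarrow> 'v \<Rightarrow> 'v) \<Rightarrow>
   ('v \<Rightarrow> 'g) \<Rightarrow> ('v \<Rightarrow> 'g) set" where
  "RB_coboundaries sg br tbr sv \<rho> \<mu> T = RB_delta sg br tbr sv \<rho> \<mu> T ` ext2 sg"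

definition RB_cohomologous ::
  "('k::field \<Rightarrow> 'g::ab_group_add \<Rightarrow> 'g) \<Rightarrow> ('g \<Rightarrow> 'g \<Rightarrow> 'g) \<Rightarrow> ('g \<Rightarrow> 'g \<Rightarrow> 'g \<Rightarrow> 'g) \<Rightarrow>
   ('k \<Rightarrow> 'v::ab_group_add \<Rightarrow> 'v) \<Rightarrow> ('g \<Rightarrow> 'v \<Rightarrow> 'v) \<Rightarrow> ('g \<Rightarrow> 'g \<Rightarrow> 'v \<Rightarrow> 'v) \<Rightarrow>
   ('v \<Rightarrow> 'g) \<Rightarrow> (('v \<Rightarrow> 'g) \<times> ('v \<Rightarrow> 'g)) set" where
  "RB_cohomologous sg br tbr sv \<rho> \<mu> T =
     {(f, g). f \<in> RB_cocycles sg br tbr sv \<rho> \<mu> T \<and> g \<in> RB_cocycles sg br tbr sv \<rho> \<mu> T \<and>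
        (\<lambda>v. f v - g v) \<in> RB_coboundaries sg br tbr sv \<rho> \<mu> T}"

definition RB_cohomology ::
  "('k::field \<Rightarrow> 'g::ab_group_add \<Rightarrow> 'g) \<Rightarrow> ('g \<Rightarrow> 'g \<Rightarrow> 'g) \<Rightarrow> ('g \<Rightarrow> 'g \<Rightarrow> 'g \<Rightarrow> 'g) \<Rightarrow>
   ('k \<Rightarrow> 'v::ab_group_add \<Rightarrow> 'v) \<Rightarrow> ('g \<Rightarrow> 'v \<Rightarrow> 'v) \<Rightarrow> ('g \<Rightarrow> 'g \<Rightarrow> 'v \<Rightarrow> 'v) \<Rightarrow>
   ('v \<Rightarrow> 'g) \<Rightarrow> ('v \<Rightarrow> 'g) set set" where
  "RB_cohomology sg br tbr sv \<rho> \<mu> T =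
     RB_cocycles sg br tbr sv \<rho> \<mu> T // RB_cohomologous sg br tbr sv \<rho> \<mu> T"

lemma (in lie_yamaguti_representation) RB_cohomologous_equiv:
  assumes T: "Vector_Spaces.linear sv sg T"
  shows "equiv (RB_cocycles sg br tbr sv \<rho> \<mu> T) (RB_cohomologous sg br tbr sv \<rho> \<mu> T)"
proof -
  let ?B = "RB_coboundaries sg br tbr sv \<rho> \<mu> T"
  let ?d = "\<lambda>p. RB_delta sg br tbr sv \<rho> \<mu> T (ext2_class sg p)"
  interpret T: Vector_Spaces.linear sv sg T by (rule T)
  have W: "vector_space sg" "vector_space sv" by unfold_locales
  have d: "?d p v = T (free_lift sv (\<lambda>x y. rep_D br \<rho> \<mu> x y v) p)
      - free_lift sg (\<lambda>x y. tbr x y (T v)) p" for p v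
    by (simp add: RB_delta_def ext2_D_def ext2_L_def ext2_lift_class[OF rep_D_alternating]
        ext2_lift_class[OF tbr_alternating])
  have B: "f \<in> ?B \<longleftrightarrow> (\<exists>p. f = ?d p)" for f
    by (auto simp: RB_coboundaries_def ext2_def)
  have zero: "(\<lambda>v. 0) \<in> ?B"
    unfolding B by (rule exI[of _ 0]) (simp add: fun_eq_iff d T.zero)
  have diff: "(\<lambda>v. f v - g v) \<in> ?B" if "f \<in> ?B" "g \<in> ?B" for f g
  proof -
    from that obtain p q where "f = ?d p" "g = ?d q" unfolding B by blast
    then show ?thesis
      unfolding B by (intro exI[of _ "p - q"])
        (simp add: fun_eq_iff d free_lift_diff[OF W(1)] free_lift_diff[OF W(2)] T.diff)
  qed
  have neg: "(\<lambda>v. - f v) \<in> ?B" if "f \<in> ?B" for f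
    using diff[OF zero that] by simp
  have sym: "(\<lambda>v. g v - f v) \<in> ?B" if "(\<lambda>v. f v - g v) \<in> ?B" for f g
    using neg[OF that] by simp
  have trans: "(\<lambda>v. f v - h v) \<in> ?B"
    if "(\<lambda>v. f v - g v) \<in> ?B" "(\<lambda>v. g v - h v) \<in> ?B" for f g h
    using diff[OF that(1) neg[OF that(2)]] by simp
  show ?thesis
    by (rule equivI; unfold refl_on_def sym_def trans_def RB_cohomologous_def)
      (use zero in \<open>auto intro: sym trans\<close>)
qed

end

theory Submission
  imports Defs
begin

text \<open>
  Each condition on a linear deformation is an identity, polynomial in the parameter \<open>t\<close> of
  degree at most 3, which holds for all \<open>t\<close>.  As the field has characteristic 0, its linear
  coefficient vanishes.  For the Rota-Baxter identities of \<open>T + t S\<close> this says that \<open>S\<close> is a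
  cocycle; for the intertwining condition of an equivalence it says that \<open>S2 - S1 = \<delta>(X)\<close>.
\<close>

text \<open>Four values of \<open>t\<close> determine four coefficients: a weighted sum of the
  values isolates \<open>scale 6 x1\<close>, and 6 is invertible in characteristic 0.\<close>

lemma cubic_linear_coeff_eq_0:
  fixes scale :: "'k::field_char_0 \<Rightarrow> 'b::ab_group_add \<Rightarrow> 'b"
  assumes "vector_space scale"
    and "\<And>t. x0 + scale t x1 + scale (t ^ 2) x2 + scale (t ^ 3) x3 = 0"
  shows "x1 = 0"
proof -
  interpret vector_space scale by fact
  let ?f = "\<lambda>t. x0 + scale t x1 + scale (t ^ 2) x2 + scale (t ^ 3) x3"
  \<comment> \<open>The weights annihilate the values of 1, \<open>t\<^sup>2\<close> and \<open>t\<^sup>3\<close> at 1, -1, 2, 0.\<close>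
  have "scale 6 x1 = scale 6 (?f 1) - scale 2 (?f (- 1)) - ?f 2 - scale 3 (?f 0)"
  proof -
    have "x0 = scale 1 x0" by simp
    then have "scale 6 (?f 1) - scale 2 (?f (- 1)) - ?f 2 - scale 3 (?f 0)
      = scale (6 - 2 - 1 - 3) x0 + scale (6 + 2 - 2) x1 + scale (6 - 2 - 4) x2
        + scale (6 + 2 - 8) x3"
      unfolding scale_left_diff_distrib scale_left_distrib scale_right_distrib
      by simp
    then show ?thesis by simp
  qed
  then have "scale 6 x1 = 0"
    \<comment> \<open>The four values vanish by \<open>assms(2)\<close> first, before arithmetic on
      the powers of \<open>t\<close> can change their shape.\<close>
    by (simp only: assms(2)) simp
  then show ?thesis
    by simp
qed

lemma alternating_bilinearD:
  assumes "alternating_bilinear sg sw f"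
  shows "f (x + x') y = f x y + f x' y" "f x (y + y') = f x y + f x y'"
    "f (sg c x) y = sw c (f x y)" "f x (sg c y) = sw c (f x y)"
    "f y x = - f x y"
proof -
  show add: "f (x + x') y = f x y + f x' y" "f x (y + y') = f x y + f x y'" for x x' y y'
    using assms by (auto simp: alternating_bilinear_def Vector_Spaces.linear_iff)
  show "f (sg c x) y = sw c (f x y)" "f x (sg c y) = sw c (f x y)"
    using assms by (auto simp: alternating_bilinear_def Vector_Spaces.linear_iff)
  \<comment> \<open>Polarization: expanding the first equation leaves only the mixed terms.\<close>
  have "f (x + y) (x + y) = 0" "f x x = 0" "f y y = 0"
    using assms by (auto simp: alternating_bilinear_def)
  then have "f y x + f x y = 0"
    by (simp add: add)
  then show "f y x = - f x y"
    by (simp add: eq_neg_iff_add_eq_0)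
qed

context lie_yamaguti_representation
begin

lemma linear_simps:
  "\<rho> (x + x') v = \<rho> x v + \<rho> x' v" "\<rho> (sg c x) v = sv c (\<rho> x v)"
  "\<mu> (x + x') y v = \<mu> x y v + \<mu> x' y v" "\<mu> (sg c x) y v = sv c (\<mu> x y v)"
  "\<mu> x (y + y') v = \<mu> x y v + \<mu> x y' v" "\<mu> x (sg c y) v = sv c (\<mu> x y v)"
  "tbr x y (z + z') = tbr x y z + tbr x y z'" "tbr x y (sg c z) = sg c (tbr x y z)"
  using rho_linear mu_linear_left mu_linear_right tbr_linear
  by (auto simp: Vector_Spaces.linear_iff)

text \<open>Skew-symmetry is left out because, as a rewrite rule, it applies to its own right-hand
  side. \<open>rep_D\<close> is expanded by its bilinearity and stays folded.\<close>

lemmas multilinear_simps = linear_simps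
  alternating_bilinearD(1-4)[OF br_alternating]
  alternating_bilinearD(1-4)[OF tbr_alternating]
  alternating_bilinearD(1-4)[OF rep_D_alternating]

lemma linear_deformation_imp_cocycle:
  assumes T: "Vector_Spaces.linear sv sg T"
    and "linear_deformation sg br tbr sv \<rho> \<mu> T S"
  shows "S \<in> RB_cocycles sg br tbr sv \<rho> \<mu> T"
proof -
  from assms(2) have S: "Vector_Spaces.linear sv sg S"
    \<comment> \<open>From here on \<open>R2\<close> and \<open>R3\<close> are the binary and
      ternary Rota-Baxter identities of \<open>T + t S\<close>, shadowing the representation axioms
      of these names.\<close>
    and R2: "\<And>t u v. br (T u + sg t (S u)) (T v + sg t (S v))
      = T (\<rho> (T u + sg t (S u)) v - \<rho> (T v + sg t (S v)) u)
      + sg t (S (\<rho> (T u + sg t (S u)) v - \<rho> (T v + sg t (S v)) u))"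
    and R3: "\<And>t u v w. tbr (T u + sg t (S u)) (T v + sg t (S v)) (T w + sg t (S w))
      = T (RB_tbr br \<rho> \<mu> (\<lambda>v. T v + sg t (S v)) u v w)
      + sg t (S (RB_tbr br \<rho> \<mu> (\<lambda>v. T v + sg t (S v)) u v w))"
    by (auto simp: linear_deformation_def relative_rota_baxter_def deform_def RB_tbr_def)
  interpret T: Vector_Spaces.linear sv sg T by (rule T)
  interpret S: Vector_Spaces.linear sv sg S by (rule S)
  note expand = multilinear_simps T.add T.diff T.scale S.add S.diff S.scale
    scale_right_distrib scale_right_diff_distrib
  have "br (T u) (S v) + br (S u) (T v) - T (\<rho> (S u) v - \<rho> (S v) u) - S (RB_br \<rho> T u v) = 0"
    for u v
  proof (rule cubic_linear_coeff_eq_0[OF vector_space_axioms])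
    fix t
    \<comment> \<open>The binary identity has degree 2 in \<open>t\<close>, so the cubic coefficient
      is padded with 0.\<close>
    show "(br (T u) (T v) - T (RB_br \<rho> T u v))
      + sg t (br (T u) (S v) + br (S u) (T v) - T (\<rho> (S u) v - \<rho> (S v) u) - S (RB_br \<rho> T u v))
      + sg (t ^ 2) (br (S u) (S v) - S (RB_br \<rho> S u v)) + sg (t ^ 3) 0 = 0"
      using R2[of u t v] by (simp add: RB_br_def expand power2_eq_square algebra_simps)
  qed
  then have 2: "RB_rho br \<rho> T u (S v) - RB_rho br \<rho> T v (S u) - S (RB_br \<rho> T u v) = 0" for u v
    \<comment> \<open>\<open>RB_rho\<close> keeps the \<open>T\<close> argument first in the
      bracket, so \<open>br (S u) (T v)\<close> has to be swapped.\<close>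
    using alternating_bilinearD(5)[OF br_alternating, of "T v" "S u"]
    by (simp add: RB_rho_def T.diff algebra_simps)
  \<comment> \<open>The derivative of the ternary identity at \<open>T\<close> in direction
    \<open>S\<close>: one occurrence of \<open>T\<close> at a time, the outer one included, is
    replaced by \<open>S\<close>.\<close>
  let ?dT = "\<lambda>u v w. tbr (T u) (T v) (S w) + tbr (T u) (S v) (T w) + tbr (S u) (T v) (T w)
    - T (rep_D br \<rho> \<mu> (S u) (T v) w + rep_D br \<rho> \<mu> (T u) (S v) w
        + \<mu> (S v) (T w) u + \<mu> (T v) (S w) u - \<mu> (S u) (T w) v - \<mu> (T u) (S w) v)
    - S (RB_tbr br \<rho> \<mu> T u v w)"
  have "?dT u v w = 0" for u v w
  proof (rule cubic_linear_coeff_eq_0[OF vector_space_axioms])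
    fix t
    show "(tbr (T u) (T v) (T w) - T (RB_tbr br \<rho> \<mu> T u v w)) + sg t (?dT u v w)
      + sg (t ^ 2) (tbr (T u) (S v) (S w) + tbr (S u) (S v) (T w) + tbr (S u) (T v) (S w)
        - T (RB_tbr br \<rho> \<mu> S u v w)
        - S (rep_D br \<rho> \<mu> (S u) (T v) w + rep_D br \<rho> \<mu> (T u) (S v) w
            + \<mu> (S v) (T w) u + \<mu> (T v) (S w) u - \<mu> (S u) (T w) v - \<mu> (T u) (S w) v))
      + sg (t ^ 3) (tbr (S u) (S v) (S w) - S (RB_tbr br \<rho> \<mu> S u v w)) = 0"
      using R3[of u t v w]
      by (simp add: RB_tbr_def expand power2_eq_square power3_eq_cube algebra_simps)
  qed
  moreover have "RB_D tbr \<mu> T u v (S w) + RB_mu br tbr \<rho> \<mu> T v w (S u)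
        - RB_mu br tbr \<rho> \<mu> T u w (S v) - S (RB_tbr br \<rho> \<mu> T u v w) = ?dT u v w" for u v w
    \<comment> \<open>\<open>RB_mu\<close> puts its argument \<open>S v\<close> in the first slot;
      swapping it with \<open>T u\<close> absorbs the minus sign of that summand.\<close>
    using alternating_bilinearD(5)[OF tbr_alternating, of "S v" "T u" "T w"]
      alternating_bilinearD(5)[OF rep_D_alternating, of "T u" "S v" w]
    by (simp add: RB_D_def RB_mu_def T.add T.diff T.neg algebra_simps)
  ultimately show ?thesis
    using S 2 by (simp add: RB_cocycles_def)
qed

lemma equivalent_deformations_imp_coboundary:
  assumes T: "Vector_Spaces.linear sv sg T" and S1: "Vector_Spaces.linear sv sg S1"
    and "equivalent_deformations sg br tbr sv \<rho> \<mu> T S1 S2"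
  shows "(\<lambda>v. S2 v - S1 v) \<in> RB_coboundaries sg br tbr sv \<rho> \<mu> T"
proof -
  interpret T: Vector_Spaces.linear sv sg T by (rule T)
  interpret S1: Vector_Spaces.linear sv sg S1 by (rule S1)
  from assms(3) obtain X where "X \<in> ext2 sg"
    and hom: "\<And>t. rota_baxter_hom sg br tbr sv \<rho> \<mu> (deform sg T S2 t) (deform sg T S1 t)
      (\<lambda>x. x + sg t (ext2_L sg tbr X x)) (\<lambda>v. v + sv t (ext2_D br sv \<rho> \<mu> X v))"
    by (auto simp: equivalent_deformations_def)
  let ?L = "ext2_L sg tbr X" and ?D = "ext2_D br sv \<rho> \<mu> X"
  \<comment> \<open>Linearity of \<open>?L\<close> comes from the homomorphism at
    \<open>t = 1\<close>, by subtracting the identity.\<close>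
  have "Vector_Spaces.linear sg sg (\<lambda>x. x + sg 1 (?L x))"
    using hom[of 1] unfolding rota_baxter_hom_def lie_yamaguti_hom_def by blast
  then have L: "?L (x + y) = ?L x + ?L y" "?L (sg c x) = sg c (?L x)" for x y c
    by (auto simp: Vector_Spaces.linear_iff algebra_simps scale_right_distrib)
  have "S1 v + T (?D v) - S2 v - ?L (T v) = 0" for v
  proof (rule cubic_linear_coeff_eq_0[OF vector_space_axioms])
    fix t
    have "(deform sg T S1 t \<circ> (\<lambda>v. v + sv t (?D v))) v
        = ((\<lambda>x. x + sg t (?L x)) \<circ> deform sg T S2 t) v"
      using hom[of t] unfolding rota_baxter_hom_def by metis
    \<comment> \<open>Both sides have constant term \<open>T v\<close>, and the degree is at most 2;
      hence the two zero coefficients.\<close>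
    then show "0 + sg t (S1 v + T (?D v) - S2 v - ?L (T v)) + sg (t ^ 2) (S1 (?D v) - ?L (S2 v))
      + sg (t ^ 3) 0 = 0"
      by (simp add: deform_def L T.add T.scale S1.add S1.scale scale_right_distrib
          scale_right_diff_distrib power2_eq_square algebra_simps)
  qed
  then have "S2 v - S1 v = RB_delta sg br tbr sv \<rho> \<mu> T X v" for v
    by (simp add: RB_delta_def algebra_simps)
  with \<open>X \<in> ext2 sg\<close> show ?thesis
    by (auto simp: RB_coboundaries_def)
qed

end

theorem theorem5p6:
  fixes sg :: "'k::field_char_0 \<Rightarrow> 'g::ab_group_add \<Rightarrow> 'g"
    and br :: "'g \<Rightarrow> 'g \<Rightarrow> 'g"
    and tbr :: "'g \<Rightarrow> 'g \<Rightarrow> 'g \<Rightarrow> 'g"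
    and sv :: "'k \<Rightarrow> 'v::ab_group_add \<Rightarrow> 'v"
    and \<rho> :: "'g \<Rightarrow> 'v \<Rightarrow> 'v"
    and \<mu> :: "'g \<Rightarrow> 'g \<Rightarrow> 'v \<Rightarrow> 'v"
    and T S1 S2 :: "'v \<Rightarrow> 'g"
  assumes "lie_yamaguti_algebra sg br tbr"
    and "lie_yamaguti_representation sg br tbr sv \<rho> \<mu>"
    and "relative_rota_baxter sg br tbr sv \<rho> \<mu> T"
    and "linear_deformation sg br tbr sv \<rho> \<mu> T S1"
    and "linear_deformation sg br tbr sv \<rho> \<mu> T S2"
    and "equivalent_deformations sg br tbr sv \<rho> \<mu> T S1 S2"
  shows "\<exists>c\<in>RB_cohomology sg br tbr sv \<rho> \<mu> T. S1 \<in> c \<and> S2 \<in> c"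
proof -
  interpret lie_yamaguti_representation sg br tbr sv \<rho> \<mu> by fact
  let ?R = "RB_cohomologous sg br tbr sv \<rho> \<mu> T"
  have T: "Vector_Spaces.linear sv sg T" and S1: "Vector_Spaces.linear sv sg S1"
    using assms(3,4) by (auto simp: relative_rota_baxter_def linear_deformation_def)
  note equiv = RB_cohomologous_equiv[OF T]
  have "S1 \<in> RB_cocycles sg br tbr sv \<rho> \<mu> T" and S2: "S2 \<in> RB_cocycles sg br tbr sv \<rho> \<mu> T"
    using assms(4,5) by (auto intro: linear_deformation_imp_cocycle[OF T])
  \<comment> \<open>The order of the pair follows the sign in \<open>S2 - S1 = \<delta>(X)\<close>,
    so the class of \<open>S2\<close> serves as the common class.\<close>
  then have "(S2, S1) \<in> ?R"
    using equivalent_deformations_imp_coboundary[OF T S1 assms(6)]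
    by (simp add: RB_cohomologous_def)
  moreover have "S2 \<in> ?R `` {S2}"
    using S2 by (rule equiv_class_self[OF equiv])
  moreover have "?R `` {S2} \<in> RB_cohomology sg br tbr sv \<rho> \<mu> T"
    using S2 unfolding RB_cohomology_def by (rule quotientI)
  ultimately show ?thesis by blast
qed

end
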